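(* For any graphs $G$ and $H$ with no isolated vertices, $$\chi_{i}(G\odot H)\in\big\{\chi_{i}(G),\ |V(H)|+\Delta(G),\ |V(H)|+\Delta(G)+1\big\}.$$
   Context: All graphs are finite and simple. An injective $k$-coloring of a graph $G$ is a function $f:V(G)\to\{1,\dots,k\}$ such that no vertex is adjacent to two distinct vertices $u,w$ with $f(u)=f(w)$; $\chi_i(G)$, the injective chromatic number, is the minimum such $k$. $\Delta(G)$ is the maximum degree of $G$. For $V(G)=\{v_1,\dots,v_n\}$, the corona product $G\odot H$ is obtained from the disjoint union of $G$ and $n$ disjoint copies $H_1,\dots,H_n$ of $H$ by joining $v_i$ to every vertex of $H_i$, for each $i\in\{1,\dots,n\}$. *)

theory Defs
  imports "Graph_Theory.Pair_Digraph"
begin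

text \<open>
  A finite simple graph is a \<^locale>\<open>pair_graph\<close>: a finite loop-free symmetric digraph
  without parallel arcs, each edge \<open>uv\<close> being present as the two arcs \<open>(u, v)\<close> and \<open>(v, u)\<close>.
  Thus the neighbours of \<open>v\<close> are the \<open>u\<close> with \<open>(v, u) \<in> parcs G\<close>, and the degree of a vertex
  is its out-degree. The null graph is included.
\<close>

definition no_isolated_vertices :: "'a pair_pre_digraph \<Rightarrow> bool" where
  "no_isolated_vertices G \<longleftrightarrow> (\<forall>v \<in> pverts G. \<exists>u. (v, u) \<in> parcs G)"

text \<open>The inserted \<open>0\<close> only matters for the null graph.\<close>

definition max_degree :: "'a pair_pre_digraph \<Rightarrow> nat" where
  "max_degree G = Max (insert 0 (out_degree (with_proj G) ` pverts G))"

definition injective_coloring :: "'a pair_pre_digraph \<Rightarrow> nat \<Rightarrow> ('a \<Rightarrow> nat) \<Rightarrow> bool" where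
  "injective_coloring G k f \<longleftrightarrow>
     f ` pverts G \<subseteq> {1..k} \<and>
     \<not> (\<exists>v u w. (v, u) \<in> parcs G \<and> (v, w) \<in> parcs G \<and> u \<noteq> w \<and> f u = f w)"

definition injective_chromatic_number :: "'a pair_pre_digraph \<Rightarrow> nat" where
  "injective_chromatic_number G = (LEAST k. \<exists>f. injective_coloring G k f)"

text \<open>\<open>Inl v\<close> is the vertex \<open>v\<close> of \<open>G\<close>, and \<open>Inr (v, x)\<close> is the vertex \<open>x\<close> of the copy
  of \<open>H\<close> attached to \<open>v\<close>.\<close>

definition corona ::
  "'a pair_pre_digraph \<Rightarrow> 'b pair_pre_digraph \<Rightarrow> ('a + 'a \<times> 'b) pair_pre_digraph" where
  "corona G H =
     \<lparr> pverts = Inl ` pverts G \<union> Inr ` (pverts G \<times> pverts H),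
       parcs = {(Inl u, Inl v) | u v. (u, v) \<in> parcs G}
             \<union> {(Inr (v, x), Inr (v, y)) | v x y. v \<in> pverts G \<and> (x, y) \<in> parcs H}
             \<union> {(Inl v, Inr (v, x)) | v x. v \<in> pverts G \<and> x \<in> pverts H}
             \<union> {(Inr (v, x), Inl v) | v x. v \<in> pverts G \<and> x \<in> pverts H} \<rparr>"

lemma pair_graph_corona:
  assumes "pair_graph G" "pair_graph H"
  shows "pair_graph (corona G H)"
proof -
  interpret G: pair_graph G by fact
  interpret H: pair_graph H by fact
  have symG: "(u, v) \<in> parcs G \<Longrightarrow> (v, u) \<in> parcs G" for u v
    using G.pair_sym_arcs by (auto simp: symmetric_def dest: symD)
  have symH: "(u, v) \<in> parcs H \<Longrightarrow> (v, u) \<in> parcs H" for u v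
    using H.pair_sym_arcs by (auto simp: symmetric_def dest: symD)
  have wf: "parcs (corona G H) \<subseteq> pverts (corona G H) \<times> pverts (corona G H)"
    by (auto simp: corona_def dest: G.wellformed' H.wellformed')
  have fin: "finite (pverts (corona G H))"
    by (simp add: corona_def G.pair_finite_verts H.pair_finite_verts)
  show ?thesis
  proof unfold_locales
    show "finite (parcs (corona G H))"
      using wf fin by (meson finite_SigmaI finite_subset)
    show "symmetric (with_proj (corona G H))"
      by (auto simp: symmetric_def corona_def intro!: symI dest: symG symH)
    show "fst e \<noteq> snd e" if "e \<in> parcs (corona G H)" for e
      using that by (auto simp: corona_def dest: G.pair_no_loops H.pair_no_loops)
  qed (use wf fin in auto)
qed

lemma ex_injective_coloring:
  assumes "pair_graph G"
  shows "\<exists>k f. injective_coloring G k f"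
proof -
  interpret G: pair_graph G by fact
  obtain g where g: "bij_betw g (pverts G) {1..card (pverts G)}"
    using G.pair_finite_verts by (metis finite_same_card_bij finite_atLeastAtMost card_atLeastAtMost diff_Suc_1)
  then have "injective_coloring G (card (pverts G)) g"
    unfolding injective_coloring_def bij_betw_def inj_on_def using G.wellformed' by blast
  then show ?thesis by blast
qed

end

theory Submission
  imports Defs
begin

text \<open>
  In the corona, the copy of \<open>H\<close> at \<open>v\<close> lies in the neighbourhood of \<open>v\<close>, so its vertices
  receive distinct colors that also avoid the colors of the \<open>G\<close>-neighbours of \<open>v\<close>; the
  largest neighbourhood gives the lower bound \<open>|V(H)| + \<Delta>(G)\<close>. Conversely, a coloring of \<open>G\<close>
  extends to the copy at \<open>v\<close> as soon as \<open>|V(H)|\<close> colors remain outside the closed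
  neighbourhood of \<open>v\<close>, which is guaranteed by \<open>|V(H)| + \<Delta>(G) + 1\<close> colors in total. Copies at
  different vertices do not interact.
\<close>

lemma out_degree_with_proj: "out_degree (with_proj G) v = card {u. (v, u) \<in> parcs G}"
proof -
  have "out_arcs (with_proj G) v = Pair v ` {u. (v, u) \<in> parcs G}"
    by (auto simp: out_arcs_def)
  then show ?thesis
    by (simp add: out_degree_def card_image inj_on_def)
qed

lemma (in pair_graph) finite_neighbours: "finite {u. (v, u) \<in> parcs G}"
  by (rule finite_subset[OF _ pair_finite_verts]) (use wellformed' in auto)

lemma (in pair_graph) out_degree_le_max_degree:
  assumes "v \<in> pverts G"
  shows "out_degree (with_proj G) v \<le> max_degree G"
  unfolding max_degree_def using assms pair_finite_verts by (intro Max_ge) auto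

lemma (in pair_graph) max_degree_attained:
  assumes "pverts G \<noteq> {}"
  obtains v where "v \<in> pverts G" "out_degree (with_proj G) v = max_degree G"
proof -
  let ?D = "out_degree (with_proj G) ` pverts G"
  have "max_degree G \<in> insert 0 ?D"
    unfolding max_degree_def using pair_finite_verts by (intro Max_in) auto
  \<comment> \<open>The inserted \<open>0\<close> might be the maximum without being a degree. If
    the maximum is \<open>0\<close>, any vertex attains it, and \<open>G\<close> has one.\<close>
  moreover have "max_degree G \<in> ?D" if "max_degree G = 0"
    using assms that out_degree_le_max_degree by fastforce
  ultimately show ?thesis
    using that by auto
qed

text \<open>All neighbours of \<open>v\<close> share the neighbour \<open>v\<close>, so
  \<open>f\<close> maps the neighbourhood injectively into \<open>{1..k}\<close>.\<close>

lemma (in pair_graph) out_degree_le_injective_coloring: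
  assumes "injective_coloring G k f"
  shows "out_degree (with_proj G) v \<le> k"
proof -
  have "inj_on f {u. (v, u) \<in> parcs G}"
    using assms unfolding injective_coloring_def by (intro inj_onI) blast
  moreover have "f ` {u. (v, u) \<in> parcs G} \<subseteq> {1..k}"
    using assms wellformed' by (fastforce simp: injective_coloring_def)
  ultimately have "card {u. (v, u) \<in> parcs G} \<le> card {1..k}"
    by (intro card_inj_on_le) auto
  then show ?thesis
    by (simp add: out_degree_with_proj)
qed

lemma injective_coloring_mono:
  assumes "injective_coloring G k f" "k \<le> l"
  shows "injective_coloring G l f"
  using assms unfolding injective_coloring_def by fastforce

lemma injective_chromatic_number_le:
  assumes "injective_coloring G k f"
  shows "injective_chromatic_number G \<le> k"
  unfolding injective_chromatic_number_def using assms by (auto intro: Least_le)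

lemma injective_chromatic_number_attained:
  assumes "pair_graph G"
  obtains f where "injective_coloring G (injective_chromatic_number G) f"
  unfolding injective_chromatic_number_def
  using LeastI_ex[OF ex_injective_coloring[OF assms]] by blast

lemma injective_chromatic_number_null:
  assumes "pair_graph G" "pverts G = {}"
  shows "injective_chromatic_number G = 0"
proof -
  interpret pair_graph G by fact
  have "injective_coloring G 0 f" for f
    using assms(2) wellformed' by (auto simp: injective_coloring_def)
  then show ?thesis
    using injective_chromatic_number_le by blast
qed

text \<open>Two neighbours of \<open>v\<close> in \<open>G\<close> remain neighbours of
  \<open>Inl v\<close> in the corona, so a conflict in \<open>G\<close> would be one in the
  corona.\<close>

lemma injective_coloring_corona_restrict:
  assumes "injective_coloring (corona G H) k F"
  shows "injective_coloring G k (F \<circ> Inl)"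
  unfolding injective_coloring_def
proof (intro conjI notI)
  show "(F \<circ> Inl) ` pverts G \<subseteq> {1..k}"
    using assms by (auto simp: injective_coloring_def corona_def)
next
  assume "\<exists>v u w. (v, u) \<in> parcs G \<and> (v, w) \<in> parcs G \<and> u \<noteq> w \<and> (F \<circ> Inl) u = (F \<circ> Inl) w"
  then obtain v u w where "(v, u) \<in> parcs G" "(v, w) \<in> parcs G" "u \<noteq> w" "F (Inl u) = F (Inl w)"
    by auto
  moreover from this have "(Inl v, Inl u) \<in> parcs (corona G H)" "(Inl v, Inl w) \<in> parcs (corona G H)"
    by (auto simp: corona_def)
  ultimately show False
    using assms unfolding injective_coloring_def by blast
qed

lemma out_degree_corona_Inl:
  assumes "pair_graph G" "pair_graph H" "v \<in> pverts G"
  shows "out_degree (with_proj (corona G H)) (Inl v)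
       = out_degree (with_proj G) v + card (pverts H)"
proof -
  interpret G: pair_graph G by fact
  interpret H: pair_graph H by fact
  have "{u. (Inl v, u) \<in> parcs (corona G H)}
      = Inl ` {u. (v, u) \<in> parcs G} \<union> (\<lambda>x. Inr (v, x)) ` pverts H"
    using assms(3) by (auto simp: corona_def)
  moreover have "card \<dots> = card {u. (v, u) \<in> parcs G} + card (pverts H)"
    using G.finite_neighbours H.pair_finite_verts
    by (subst card_Un_disjoint) (auto simp: card_image inj_on_def)
  ultimately show ?thesis
    by (simp add: out_degree_with_proj)
qed

lemma injective_coloring_corona_extend:
  assumes "pair_graph G" "pair_graph H"
    and f: "injective_coloring G k f"
    and k: "card (pverts H) + max_degree G + 1 \<le> k"
  shows "\<exists>F. injective_coloring (corona G H) k F"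
proof -
  interpret G: pair_graph G by fact
  interpret H: pair_graph H by fact
  \<comment> \<open>Colors barred from the copy at \<open>v\<close>: a neighbour \<open>u\<close> of
    \<open>v\<close> and a copy vertex both see \<open>Inl v\<close>, while \<open>v\<close> and a
    copy vertex \<open>y\<close> both see \<open>Inr (v, x)\<close> whenever \<open>x\<close> and
    \<open>y\<close> are adjacent in \<open>H\<close>.\<close>
  let ?N = "\<lambda>v. insert v {u. (v, u) \<in> parcs G}"
  have "\<exists>g. g ` pverts H \<subseteq> {1..k} - f ` ?N v \<and> inj_on g (pverts H)" if "v \<in> pverts G" for v
  proof (rule card_le_inj)
    have "card (f ` ?N v) \<le> card (?N v)"
      using G.finite_neighbours by (intro card_image_le) auto
    also have "\<dots> \<le> out_degree (with_proj G) v + 1"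
      using G.finite_neighbours by (simp add: out_degree_with_proj card_insert_if)
    also have "\<dots> \<le> max_degree G + 1"
      using G.out_degree_le_max_degree[OF that] by simp
    finally have "card (f ` ?N v) \<le> max_degree G + 1" .
    moreover have "card {1..k} - card (f ` ?N v) \<le> card ({1..k} - f ` ?N v)"
      using G.finite_neighbours by (intro diff_card_le_card_Diff) auto
    ultimately show "card (pverts H) \<le> card ({1..k} - f ` ?N v)"
      using k by simp
  qed (use H.pair_finite_verts in auto)
  then obtain g where g: "\<And>v. v \<in> pverts G \<Longrightarrow> g v ` pverts H \<subseteq> {1..k} - f ` ?N v"
    and inj: "\<And>v. v \<in> pverts G \<Longrightarrow> inj_on (g v) (pverts H)"
    by metis
  define F where "F = case_sum f (\<lambda>(v, x). g v x)"
  have F[simp]: "F (Inl v) = f v" "F (Inr (v, x)) = g v x" for v x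
    by (simp_all add: F_def)
  have range: "f v \<in> {1..k}" if "v \<in> pverts G" for v
    using f that by (auto simp: injective_coloring_def)
  have inj_f: "u = w" if "(v, u) \<in> parcs G" "(v, w) \<in> parcs G" "f u = f w" for v u w
    using f that unfolding injective_coloring_def by blast
  have inj_g: "x = y" if "v \<in> pverts G" "x \<in> pverts H" "y \<in> pverts H" "g v x = g v y" for v x y
    using inj that by (auto dest: inj_onD)
  have g_self: "g v x \<noteq> f v" if "v \<in> pverts G" "x \<in> pverts H" for v x
    using g that by auto
  have g_adj: "g v x \<noteq> f u" if "v \<in> pverts G" "x \<in> pverts H" "(v, u) \<in> parcs G" for v x u
    using g[OF that(1)] that(2,3) by auto
  \<comment> \<open>Around \<open>Inl v\<close> lie its neighbours in \<open>G\<close> and its whole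
    copy, and \<open>g_adj\<close> settles the mixed pairs. Around \<open>Inr (v, x)\<close> lie
    only \<open>Inl v\<close> and vertices of the same copy, and \<open>g_self\<close> settles the
    mixed pairs.\<close>
  have "u = w" if "(z, u) \<in> parcs (corona G H)" "(z, w) \<in> parcs (corona G H)" "F u = F w" for z u w
  proof (cases z)
    case (Inl v)
    then show ?thesis
      using that by (auto simp: corona_def g_adj g_adj[THEN not_sym] intro: inj_f inj_g)
  next
    case (Inr p)
    then show ?thesis
      using that by (auto simp: corona_def g_self g_self[THEN not_sym] dest: H.wellformed' intro: inj_g)
  qed
  moreover have "F ` pverts (corona G H) \<subseteq> {1..k}"
    using g range by (force simp: corona_def)
  ultimately have "injective_coloring (corona G H) k F"
    unfolding injective_coloring_def by blast
  then show ?thesis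
    by blast
qed

theorem theorem3p2:
  fixes G :: "'a pair_pre_digraph" and H :: "'b pair_pre_digraph"
  assumes "pair_graph G" and "pair_graph H"
    and "no_isolated_vertices G" and "no_isolated_vertices H"
  shows "injective_chromatic_number (corona G H) \<in>
           {injective_chromatic_number G,
            card (pverts H) + max_degree G,
            card (pverts H) + max_degree G + 1}"
proof (cases "pverts G = {}")
  \<comment> \<open>Separate because the lower bound \<open>card (pverts H) + max_degree G\<close>
    can fail here: the corona is null and needs \<open>0\<close> colors, as does \<open>G\<close>,
    even if \<open>H\<close> has vertices.\<close>
  case True
  then have "pverts (corona G H) = {}"
    by (simp add: corona_def)
  then show ?thesis
    using True assms(1,2) by (simp add: injective_chromatic_number_null pair_graph_corona)
next
  case False
  interpret G: pair_graph G by fact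
  interpret C: pair_graph "corona G H"
    using assms(1,2) by (rule pair_graph_corona)
  let ?c = "injective_chromatic_number (corona G H)"
  let ?m = "card (pverts H) + max_degree G"
  obtain F where F: "injective_coloring (corona G H) ?c F"
    by (rule injective_chromatic_number_attained) unfold_locales
  obtain f where f: "injective_coloring G (injective_chromatic_number G) f"
    by (rule injective_chromatic_number_attained[OF assms(1)])
  have "injective_chromatic_number G \<le> ?c"
    by (rule injective_chromatic_number_le[OF injective_coloring_corona_restrict[OF F]])
  moreover have "?m \<le> ?c"
  proof -
    obtain v where "v \<in> pverts G" "out_degree (with_proj G) v = max_degree G"
      using G.max_degree_attained[OF False] .
    then show ?thesis
      using C.out_degree_le_injective_coloring[OF F, of "Inl v"] assms(1,2)
      by (simp add: out_degree_corona_Inl)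
  qed
  moreover have "?c \<le> max (injective_chromatic_number G) (?m + 1)"
  proof -
    \<comment> \<open>The palette is enlarged, not the coloring changed: \<open>f\<close> stays
      valid and the extra colors leave room for the copies.\<close>
    have "injective_coloring G (max (injective_chromatic_number G) (?m + 1)) f"
      using f by (rule injective_coloring_mono) simp
    then show ?thesis
      using injective_coloring_corona_extend[OF assms(1,2)] injective_chromatic_number_le
      by (metis max.cobounded2)
  qed
  \<comment> \<open>If \<open>injective_chromatic_number G\<close> is at least
    \<open>?m + 1\<close>, the bounds force \<open>?c\<close> to equal it; otherwise
    \<open>?c\<close> lies between \<open>?m\<close> and \<open>?m + 1\<close>.\<close>
  ultimately show ?thesis
    by (auto simp: max_def split: if_splits)
qed

end
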